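(* Let $X$, $Y$ be topological spaces, $A\subset X$, $B\subset Y$, and let $(F,F')$ and $(G,G')$ be closed correspondences from $(X,A)$ to $(Y,B)$ such that $(G,G')$ is an enlargement of $(F,F')$ and $(G,G')$ is homologically consistent. Then $(G,G')$ is a homological extension of $(F,F')$.
   Context: $H_*$ denotes a fixed homology theory on pairs of topological spaces (any choice is allowed, e.g. singular homology) with coefficients in a fixed arbitrary ring $R$. A correspondence from $(X,A)$ to $(Y,B)$ is a pair $(F,F')$ of relations with $F\subset X\times Y$, $F'\subset A\times B$ and $F'\subset F$ (relations are identified with their graphs, with the subspace topology from $X\times Y$). It is closed if both $F$ and $F'$ are closed subsets of $X\times Y$. A correspondence $(G,G')$ is an enlargement of $(F,F')$ if $F\subset G$ and $F'\subset G'$. For a closed correspondence $(F,F')$ let $p^F\colon (F,F')\to (X,A)$ and $q^F\colon (F,F')\to (Y,B)$ be the canonical projections (similarly $p^G,q^G$ for $(G,G')$). $(F,F')$ is homologically consistent if $\ker p^F_*\subset \ker q^F_*$. Induced homomorphism of a closed correspondence: let $\widetilde{p^F_*}\colon H_*(F,F')/\ker p^F_*\to \operatorname{im} p^F_*$ be the isomorphism induced by $p^F_*$, and let $\widetilde{q^F_*}\colon H_*(F,F')/\ker p^F_*\to H_*(Y,B)/q^F_*(\ker p^F_* )$ be the homomorphism induced by $q^F_*$. Then $$(F,F')_* := \widetilde{q^F_*}\circ (\widetilde{p^F_*})^{-1}\colon \operatorname{im} p^F_*\to H_*(Y,B)/q^F_*(\ker p^F_* ).$$ For closed correspondences $(F,F')$,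 $(G,G')$ from $(X,A)$ to $(Y,B)$, $(G,G')$ is a homological extension of $(F,F')$ if: (1) $\operatorname{im} p^F_*\subset \operatorname{im} p^G_*$, which yields the inclusion homomorphism $i\colon \operatorname{im} p^F_*\to \operatorname{im} p^G_*$; (2) $q^G_*(\ker p^G_* )\subset q^F_*(\ker p^F_* )$, which yields the natural projection $j\colon H_*(Y,B)/q^G_*(\ker p^G_* )\to H_*(Y,B)/q^F_*(\ker p^F_* )$; (3) $(F,F')_* = j\circ (G,G')_*\circ i$. *)

theory Defs
  imports "HOL-Algebra.Module" "HOL-Algebra.AbelCoset" "HOL-Analysis.Homotopy"
begin

section \<open>Modules over an arbitrary ring\<close>

text \<open>The library locale \<open>module\<close> requires a commutative ring of scalars. The coefficient ring is
  arbitrary here, so left modules over a possibly non-commutative ring are used, on the library's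
  record type \<open>module\<close>. The multiplicative fields of that record play no role.\<close>

locale left_module = R?: ring R + M?: abelian_group M
  for R (structure) and M (structure) +
  assumes smult_closed:
      "\<lbrakk>a \<in> carrier R; x \<in> carrier M\<rbrakk> \<Longrightarrow> a \<odot>\<^bsub>M\<^esub> x \<in> carrier M"
    and smult_l_distr:
      "\<lbrakk>a \<in> carrier R; b \<in> carrier R; x \<in> carrier M\<rbrakk> \<Longrightarrow>
        (a \<oplus>\<^bsub>R\<^esub> b) \<odot>\<^bsub>M\<^esub> x = a \<odot>\<^bsub>M\<^esub> x \<oplus>\<^bsub>M\<^esub> b \<odot>\<^bsub>M\<^esub> x"
    and smult_r_distr:
      "\<lbrakk>a \<in> carrier R; x \<in> carrier M; y \<in> carrier M\<rbrakk> \<Longrightarrow>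
        a \<odot>\<^bsub>M\<^esub> (x \<oplus>\<^bsub>M\<^esub> y) = a \<odot>\<^bsub>M\<^esub> x \<oplus>\<^bsub>M\<^esub> a \<odot>\<^bsub>M\<^esub> y"
    and smult_assoc1:
      "\<lbrakk>a \<in> carrier R; b \<in> carrier R; x \<in> carrier M\<rbrakk> \<Longrightarrow>
        (a \<otimes>\<^bsub>R\<^esub> b) \<odot>\<^bsub>M\<^esub> x = a \<odot>\<^bsub>M\<^esub> (b \<odot>\<^bsub>M\<^esub> x)"
    and smult_one:
      "x \<in> carrier M \<Longrightarrow> \<one>\<^bsub>R\<^esub> \<odot>\<^bsub>M\<^esub> x = x"

definition lin_hom ::
  "('r, 's) ring_scheme \<Rightarrow> ('r, 'm) module \<Rightarrow> ('r, 'k) module \<Rightarrow> ('m \<Rightarrow> 'k) set" where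
  "lin_hom R M N = {f. f \<in> carrier M \<rightarrow> carrier N \<and>
     (\<forall>x\<in>carrier M. \<forall>y\<in>carrier M. f (x \<oplus>\<^bsub>M\<^esub> y) = f x \<oplus>\<^bsub>N\<^esub> f y) \<and>
     (\<forall>r\<in>carrier R. \<forall>x\<in>carrier M. f (r \<odot>\<^bsub>M\<^esub> x) = r \<odot>\<^bsub>N\<^esub> f x)}"

definition lin_iso ::
  "('r, 's) ring_scheme \<Rightarrow> ('r, 'm) module \<Rightarrow> ('r, 'k) module \<Rightarrow> ('m \<Rightarrow> 'k) set" where
  "lin_iso R M N = {f \<in> lin_hom R M N. bij_betw f (carrier M) (carrier N)}"

definition regular_module :: "('r, 's) ring_scheme \<Rightarrow> ('r, 'r) module" where
  "regular_module R = \<lparr>carrier = carrier R, mult = mult R, one = one R,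
     zero = zero R, add = add R, smult = mult R\<rparr>"

section \<open>Homology theories\<close>

text \<open>An Eilenberg--Steenrod homology theory with coefficients in \<open>R\<close>, on all pairs \<open>(X, A)\<close> of
  topological spaces whose points belong to the type \<open>'u\<close>. Since \<open>homotopic_with\<close> identifies
  continuous maps that agree on the underlying space, the homotopy axiom also says that an induced
  map does not depend on the values of a function outside that space.\<close>

record ('u, 'r, 'm) homology_data =
  Hmod :: "int \<Rightarrow> 'u topology \<Rightarrow> 'u set \<Rightarrow> ('r, 'm) module"
  Hind :: "int \<Rightarrow> 'u topology \<Rightarrow> 'u set \<Rightarrow> 'u topology \<Rightarrow> 'u set \<Rightarrow> ('u \<Rightarrow> 'u) \<Rightarrow> 'm \<Rightarrow> 'm"
  Hbd  :: "int \<Rightarrow> 'u topology \<Rightarrow> 'u set \<Rightarrow> 'm \<Rightarrow> 'm"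

definition pair_map :: "'a topology \<Rightarrow> 'a set \<Rightarrow> 'b topology \<Rightarrow> 'b set \<Rightarrow> ('a \<Rightarrow> 'b) \<Rightarrow> bool" where
  "pair_map X A Y B f \<longleftrightarrow>
     A \<subseteq> topspace X \<and> B \<subseteq> topspace Y \<and> continuous_map X Y f \<and> f ` A \<subseteq> B"

locale homology_theory = R?: ring R
  for R :: "('r, 's) ring_scheme" (structure) +
  fixes H :: "('u, 'r, 'm) homology_data"
  assumes left_module_Hmod:
      "A \<subseteq> topspace X \<Longrightarrow> left_module R (Hmod H n X A)"
    and Hind_hom:
      "pair_map X A Y B f \<Longrightarrow>
        Hind H n X A Y B f \<in> lin_hom R (Hmod H n X A) (Hmod H n Y B)"
    and Hind_id:
      "\<lbrakk>A \<subseteq> topspace X; x \<in> carrier (Hmod H n X A)\<rbrakk> \<Longrightarrow> Hind H n X A X A id x = x"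
    and Hind_comp:
      "\<lbrakk>pair_map X A Y B f; pair_map Y B Z C g; x \<in> carrier (Hmod H n X A)\<rbrakk> \<Longrightarrow>
        Hind H n X A Z C (g \<circ> f) x = Hind H n Y B Z C g (Hind H n X A Y B f x)"
    and Hbd_hom:
      "A \<subseteq> topspace X \<Longrightarrow>
        Hbd H n X A \<in> lin_hom R (Hmod H n X A) (Hmod H (n - 1) (subtopology X A) {})"
    and Hbd_natural:
      "\<lbrakk>pair_map X A Y B f; x \<in> carrier (Hmod H n X A)\<rbrakk> \<Longrightarrow>
        Hbd H n Y B (Hind H n X A Y B f x) =
        Hind H (n - 1) (subtopology X A) {} (subtopology Y B) {} f (Hbd H n X A x)"
    and exact_at_pair:
      "A \<subseteq> topspace X \<Longrightarrow>
        a_kernel (Hmod H n X A) (Hmod H (n - 1) (subtopology X A) {}) (Hbd H n X A) =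
        Hind H n X {} X A id ` carrier (Hmod H n X {})"
    and exact_at_space:
      "A \<subseteq> topspace X \<Longrightarrow>
        a_kernel (Hmod H n X {}) (Hmod H n X A) (Hind H n X {} X A id) =
        Hind H n (subtopology X A) {} X {} id ` carrier (Hmod H n (subtopology X A) {})"
    and exact_at_subspace:
      "A \<subseteq> topspace X \<Longrightarrow>
        a_kernel (Hmod H (n - 1) (subtopology X A) {}) (Hmod H (n - 1) X {})
          (Hind H (n - 1) (subtopology X A) {} X {} id) =
        Hbd H n X A ` carrier (Hmod H n X A)"
    and homotopy:
      "\<lbrakk>A \<subseteq> topspace X; B \<subseteq> topspace Y; homotopic_with (\<lambda>h. h ` A \<subseteq> B) X Y f g;
        x \<in> carrier (Hmod H n X A)\<rbrakk> \<Longrightarrow>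
        Hind H n X A Y B f x = Hind H n X A Y B g x"
    and excision:
      "\<lbrakk>A \<subseteq> topspace X; U \<subseteq> topspace X; Abstract_Topology.closure_of X U \<subseteq> X interior_of A\<rbrakk> \<Longrightarrow>
        Hind H n (subtopology X (topspace X - U)) (A - U) X A id
          \<in> lin_iso R (Hmod H n (subtopology X (topspace X - U)) (A - U)) (Hmod H n X A)"
    and dimension:
      "\<lbrakk>topspace X = {a}; n \<noteq> 0\<rbrakk> \<Longrightarrow> carrier (Hmod H n X {}) = {\<zero>\<^bsub>Hmod H n X {}\<^esub>}"
    and coefficients:
      "topspace X = {a} \<Longrightarrow> lin_iso R (regular_module R) (Hmod H 0 X {}) \<noteq> {}"

text \<open>HOL cannot quantify over one theory defined at all types simultaneously, whereas
  \<open>X\<close>, \<open>Y\<close> and the graph of a relation between them are carried by three different types. A space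
  on a type \<open>'c\<close> is therefore copied homeomorphically along an injection \<open>e :: 'c \<Rightarrow> 'u\<close>, and its
  homology is by definition that of the copy.\<close>

definition code_space :: "('c \<Rightarrow> 'u) \<Rightarrow> 'c topology \<Rightarrow> 'u topology" where
  "code_space e T = pullback_topology (range e) (inv_into UNIV e) T"

definition homology ::
  "('u, 'r, 'm) homology_data \<Rightarrow> ('c \<Rightarrow> 'u) \<Rightarrow> int \<Rightarrow> 'c topology \<Rightarrow> 'c set \<Rightarrow> ('r, 'm) module" where
  "homology H e n T S = Hmod H n (code_space e T) (e ` S)"

definition homology_map ::
  "('u, 'r, 'm) homology_data \<Rightarrow> ('c \<Rightarrow> 'u) \<Rightarrow> ('d \<Rightarrow> 'u) \<Rightarrow> int \<Rightarrow>
    'c topology \<Rightarrow> 'c set \<Rightarrow> 'd topology \<Rightarrow> 'd set \<Rightarrow> ('c \<Rightarrow> 'd) \<Rightarrow> 'm \<Rightarrow> 'm" where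
  "homology_map H e e' n T S T' S' f =
     Hind H n (code_space e T) (e ` S) (code_space e' T') (e' ` S') (e' \<circ> f \<circ> inv_into UNIV e)"

section \<open>Correspondences\<close>

definition correspondence ::
  "'a topology \<Rightarrow> 'a set \<Rightarrow> 'b topology \<Rightarrow> 'b set \<Rightarrow> ('a \<times> 'b) set \<Rightarrow> ('a \<times> 'b) set \<Rightarrow> bool" where
  "correspondence X A Y B F F' \<longleftrightarrow>
     F \<subseteq> topspace X \<times> topspace Y \<and> F' \<subseteq> A \<times> B \<and> F' \<subseteq> F"

definition closed_correspondence ::
  "'a topology \<Rightarrow> 'a set \<Rightarrow> 'b topology \<Rightarrow> 'b set \<Rightarrow> ('a \<times> 'b) set \<Rightarrow> ('a \<times> 'b) set \<Rightarrow> bool" where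
  "closed_correspondence X A Y B F F' \<longleftrightarrow>
     correspondence X A Y B F F' \<and>
     closedin (prod_topology X Y) F \<and> closedin (prod_topology X Y) F'"

definition enlargement ::
  "('a \<times> 'b) set \<Rightarrow> ('a \<times> 'b) set \<Rightarrow> ('a \<times> 'b) set \<Rightarrow> ('a \<times> 'b) set \<Rightarrow> bool" where
  "enlargement G G' F F' \<longleftrightarrow> F \<subseteq> G \<and> F' \<subseteq> G'"

section \<open>Induced homomorphisms, homological consistency and homological extension\<close>

text \<open>Elements of a quotient module are additive cosets. The map induced on \<open>M / K\<close> by a map \<open>f\<close>
  on \<open>M\<close> that is constant on the cosets of \<open>K\<close> sends a coset to the common value of \<open>f\<close> on it.\<close>

definition quotient_map_of ::
  "('r, 'm) module \<Rightarrow> 'm set \<Rightarrow> ('m \<Rightarrow> 'c) \<Rightarrow> 'm set \<Rightarrow> 'c" where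
  "quotient_map_of M K f = (\<lambda>C\<in>carrier (M A_Mod K). the_elem (f ` C))"

text \<open>\<open>eX\<close>, \<open>eY\<close>, \<open>eP\<close> are the codings of the points of \<open>X\<close>, of \<open>Y\<close> and of \<open>X \<times> Y\<close>
  in the universe \<open>'u\<close> of the homology theory. The graded modules and homomorphisms are
  treated degree by degree.\<close>

context
  fixes H :: "('u, 'r, 'm) homology_data"
    and eX :: "'a \<Rightarrow> 'u" and eY :: "'b \<Rightarrow> 'u" and eP :: "'a \<times> 'b \<Rightarrow> 'u"
    and X :: "'a topology" and A :: "'a set" and Y :: "'b topology" and B :: "'b set"
begin

definition graph_homology :: "int \<Rightarrow> ('a \<times> 'b) set \<Rightarrow> ('a \<times> 'b) set \<Rightarrow> ('r, 'm) module" where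
  "graph_homology n F F' = homology H eP n (subtopology (prod_topology X Y) F) F'"

definition p_star :: "int \<Rightarrow> ('a \<times> 'b) set \<Rightarrow> ('a \<times> 'b) set \<Rightarrow> 'm \<Rightarrow> 'm" where
  "p_star n F F' = homology_map H eP eX n (subtopology (prod_topology X Y) F) F' X A fst"

definition q_star :: "int \<Rightarrow> ('a \<times> 'b) set \<Rightarrow> ('a \<times> 'b) set \<Rightarrow> 'm \<Rightarrow> 'm" where
  "q_star n F F' = homology_map H eP eY n (subtopology (prod_topology X Y) F) F' Y B snd"

definition im_p :: "int \<Rightarrow> ('a \<times> 'b) set \<Rightarrow> ('a \<times> 'b) set \<Rightarrow> 'm set" where
  "im_p n F F' = p_star n F F' ` carrier (graph_homology n F F')"

definition ker_p :: "int \<Rightarrow> ('a \<times> 'b) set \<Rightarrow> ('a \<times> 'b) set \<Rightarrow> 'm set" where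
  "ker_p n F F' = a_kernel (graph_homology n F F') (homology H eX n X A) (p_star n F F')"

definition ker_q :: "int \<Rightarrow> ('a \<times> 'b) set \<Rightarrow> ('a \<times> 'b) set \<Rightarrow> 'm set" where
  "ker_q n F F' = a_kernel (graph_homology n F F') (homology H eY n Y B) (q_star n F F')"

definition q_ker_p :: "int \<Rightarrow> ('a \<times> 'b) set \<Rightarrow> ('a \<times> 'b) set \<Rightarrow> 'm set" where
  "q_ker_p n F F' = q_star n F F' ` ker_p n F F'"

definition homologically_consistent :: "('a \<times> 'b) set \<Rightarrow> ('a \<times> 'b) set \<Rightarrow> bool" where
  "homologically_consistent F F' \<longleftrightarrow> (\<forall>n. ker_p n F F' \<subseteq> ker_q n F F')"

definition p_tilde :: "int \<Rightarrow> ('a \<times> 'b) set \<Rightarrow> ('a \<times> 'b) set \<Rightarrow> 'm set \<Rightarrow> 'm" where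
  "p_tilde n F F' =
     quotient_map_of (graph_homology n F F') (ker_p n F F') (p_star n F F')"

definition q_tilde :: "int \<Rightarrow> ('a \<times> 'b) set \<Rightarrow> ('a \<times> 'b) set \<Rightarrow> 'm set \<Rightarrow> 'm set" where
  "q_tilde n F F' =
     quotient_map_of (graph_homology n F F') (ker_p n F F')
       (\<lambda>x. q_ker_p n F F' +>\<^bsub>homology H eY n Y B\<^esub> q_star n F F' x)"

definition induced_hom :: "int \<Rightarrow> ('a \<times> 'b) set \<Rightarrow> ('a \<times> 'b) set \<Rightarrow> 'm \<Rightarrow> 'm set" where
  "induced_hom n F F' =
     compose (im_p n F F') (q_tilde n F F')
       (inv_into (carrier (graph_homology n F F' A_Mod ker_p n F F')) (p_tilde n F F'))"

definition incl_im ::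
  "int \<Rightarrow> ('a \<times> 'b) set \<Rightarrow> ('a \<times> 'b) set \<Rightarrow> 'm \<Rightarrow> 'm" where
  "incl_im n F F' = (\<lambda>a\<in>im_p n F F'. a)"

definition proj_quot ::
  "int \<Rightarrow> ('a \<times> 'b) set \<Rightarrow> ('a \<times> 'b) set \<Rightarrow> ('a \<times> 'b) set \<Rightarrow> ('a \<times> 'b) set \<Rightarrow> 'm set \<Rightarrow> 'm set" where
  "proj_quot n G G' F F' =
     quotient_map_of (homology H eY n Y B) (q_ker_p n G G')
       (\<lambda>y. q_ker_p n F F' +>\<^bsub>homology H eY n Y B\<^esub> y)"

definition homological_extension ::
  "('a \<times> 'b) set \<Rightarrow> ('a \<times> 'b) set \<Rightarrow> ('a \<times> 'b) set \<Rightarrow> ('a \<times> 'b) set \<Rightarrow> bool" where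
  "homological_extension G G' F F' \<longleftrightarrow>
     (\<forall>n. im_p n F F' \<subseteq> im_p n G G' \<and>
          q_ker_p n G G' \<subseteq> q_ker_p n F F' \<and>
          (\<forall>a \<in> im_p n F F'.
             induced_hom n F F' a =
             (proj_quot n G G' F F' \<circ> induced_hom n G G' \<circ> incl_im n F F') a))"

end

end

theory Submission
  imports Defs
begin

text \<open>A correspondence \<open>(F, F')\<close> induces the additive relation \<open>p\<^sub>* x \<mapsto> q\<^sub>* x\<close> from
  \<open>H(X, A)\<close> to \<open>H(Y, B)\<close>: the indeterminacy of its values is \<open>q\<^sub>*(ker p\<^sub>*)\<close>, so as a map it sends
  \<open>p\<^sub>* x\<close> to the coset of \<open>q\<^sub>* x\<close> (\<open>induced_hom_p_star\<close>).

  The inclusion \<open>i\<close> of \<open>(F, F')\<close> in an enlargement \<open>(G, G')\<close> commutes with both projections, so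
  functoriality gives \<open>p\<^sup>F\<^sub>* = p\<^sup>G\<^sub>* i\<^sub>*\<close> and \<open>q\<^sup>F\<^sub>* = q\<^sup>G\<^sub>* i\<^sub>*\<close>
  (\<open>p_star_enlargement\<close>, \<open>q_star_enlargement\<close>). Hence a class \<open>p\<^sup>F\<^sub>* x\<close> also lies in
  the image of \<open>p\<^sup>G\<^sub>*\<close>, and both correspondences assign to it a coset of the same element
  \<open>q\<^sup>F\<^sub>* x = q\<^sup>G\<^sub>* (i\<^sub>* x)\<close>, for the subgroups \<open>q\<^sup>F\<^sub>*(ker p\<^sup>F\<^sub>*)\<close> and
  \<open>q\<^sup>G\<^sub>*(ker p\<^sup>G\<^sub>*)\<close> respectively. For an enlargement the second subgroup contains the first; the
  projection needed in an extension goes the other way. Consistency of \<open>(G, G')\<close> means that the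
  second subgroup is zero, which forces the two to coincide.\<close>

section \<open>Maps induced on quotients\<close>

lemma quotient_map_of_coset:
  assumes K: "abelian_subgroup K M" and x: "x \<in> carrier M"
    and const: "\<And>k. k \<in> K \<Longrightarrow> f (k \<oplus>\<^bsub>M\<^esub> x) = f x"
  shows "quotient_map_of M K f (K +>\<^bsub>M\<^esub> x) = f x"
proof -
  interpret K: abelian_subgroup K M by (rule K)
  have "K +>\<^bsub>M\<^esub> x \<in> carrier (M A_Mod K)"
    using K.a_rcosetsI[OF K.a_subset x] by (simp add: A_FactGroup_def')
  moreover have "f ` (K +>\<^bsub>M\<^esub> x) = {f x}"
  proof -
    have "K \<noteq> {}" using additive_subgroup.zero_closed[OF K.is_additive_subgroup] by blast
    have "f ` (K +>\<^bsub>M\<^esub> x) = (\<lambda>k. f (k \<oplus>\<^bsub>M\<^esub> x)) ` K"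
      by (simp only: a_r_coset_def' UNION_singleton_eq_range image_image)
    also have "\<dots> = (\<lambda>k. f x) ` K" by (rule image_cong[OF refl const])
    finally show ?thesis using \<open>K \<noteq> {}\<close> by (simp only: image_constant_conv if_False)
  qed
  ultimately show ?thesis by (simp add: quotient_map_of_def)
qed

lemma abelian_subgroup_image:
  assumes h: "abelian_group_hom M N h" and K: "additive_subgroup K M"
  shows "abelian_subgroup (h ` K) N"
proof -
  interpret h: abelian_group_hom M N h by (rule h)
  have "subgroup (h ` K) (add_monoid N)"
    using group_hom.subgroup_img_is_subgroup[OF h.a_group_hom] K
    by (simp add: additive_subgroup_def)
  then show ?thesis
    by (intro abelian_subgroupI3 additive_subgroup.intro h.H.abelian_group_axioms)
qed

lemma coset_absorb:
  assumes K: "abelian_subgroup K M" and "k \<in> K" "x \<in> carrier M"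
  shows "K +>\<^bsub>M\<^esub> (k \<oplus>\<^bsub>M\<^esub> x) = K +>\<^bsub>M\<^esub> x"
proof -
  interpret K: abelian_subgroup K M by (rule K)
  have "k \<oplus>\<^bsub>M\<^esub> x \<in> K +>\<^bsub>M\<^esub> x" using assms(2) by (auto simp: a_r_coset_def')
  then show ?thesis using K.a_repr_independence' assms(3) by metis
qed

text \<open>Any preimage of \<open>f x\<close> in the quotient is the coset of some \<open>z\<close> with \<open>f z = f x\<close>. As \<open>z\<close> and
  \<open>x\<close> then differ by an element of the kernel, \<open>g z\<close> and \<open>g x\<close> have the same coset, so the
  choice that the inverse makes is irrelevant.\<close>

lemma induced_on_quotients:
  fixes M P :: "('r, 'm) module" and N :: "('r, 'k) module" and f g
  defines "K \<equiv> a_kernel M N f"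
  assumes f: "abelian_group_hom M N f" and g: "abelian_group_hom M P g"
    and x: "x \<in> carrier M"
  shows "quotient_map_of M K (\<lambda>z. g ` K +>\<^bsub>P\<^esub> g z)
           (inv_into (carrier (M A_Mod K)) (quotient_map_of M K f) (f x))
         = g ` K +>\<^bsub>P\<^esub> g x"
proof -
  interpret f: abelian_group_hom M N f by (rule f)
  interpret g: abelian_group_hom M P g by (rule g)
  have K: "abelian_subgroup K M"
    unfolding K_def by (rule f.abelian_subgroup_a_kernel)
  interpret K: abelian_subgroup K M by (rule K)
  have gK: "abelian_subgroup (g ` K) P"
    by (rule abelian_subgroup_image[OF g K.is_additive_subgroup])
  have f_zero: "f k = \<zero>\<^bsub>N\<^esub>" if "k \<in> K" for k
    using that unfolding K_def a_kernel_def' by blast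
  have f_coset: "quotient_map_of M K f (K +>\<^bsub>M\<^esub> z) = f z" if "z \<in> carrier M" for z
    using that by (intro quotient_map_of_coset K) (simp_all add: f_zero)
  have g_coset: "quotient_map_of M K (\<lambda>z. g ` K +>\<^bsub>P\<^esub> g z) (K +>\<^bsub>M\<^esub> z) = g ` K +>\<^bsub>P\<^esub> g z"
    if "z \<in> carrier M" for z
    using that by (intro quotient_map_of_coset K) (simp_all add: coset_absorb[OF gK])
  define C where "C = inv_into (carrier (M A_Mod K)) (quotient_map_of M K f) (f x)"
  have cosets: "carrier (M A_Mod K) = {K +>\<^bsub>M\<^esub> z |z. z \<in> carrier M}"
    by (auto simp: A_FactGroup_def' A_RCOSETS_def' a_r_coset_def')
  have "f x \<in> quotient_map_of M K f ` carrier (M A_Mod K)"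
    using x f_coset[OF x, symmetric] unfolding cosets by blast
  then have "C \<in> carrier (M A_Mod K)" "quotient_map_of M K f C = f x"
    unfolding C_def by (rule inv_into_into, rule f_inv_into_f)
  then obtain z where z: "z \<in> carrier M" "C = K +>\<^bsub>M\<^esub> z" "f z = f x"
    unfolding cosets using f_coset by auto
  define k where "k = z \<ominus>\<^bsub>M\<^esub> x"
  have "k \<in> carrier M" using x z(1) unfolding k_def by (rule f.G.minus_closed[rotated])
  moreover have "f k = \<zero>\<^bsub>N\<^esub>"
    using x z(1) by (simp add: k_def a_minus_def z(3) f.H.r_neg)
  ultimately have k: "k \<in> K" unfolding K_def a_kernel_def' by blast
  have zk: "z = k \<oplus>\<^bsub>M\<^esub> x"
    using x z(1) by (simp add: k_def a_minus_def f.G.a_assoc f.G.l_neg)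
  have "g ` K +>\<^bsub>P\<^esub> g z = g ` K +>\<^bsub>P\<^esub> g x"
    unfolding zk g.hom_add[OF \<open>k \<in> carrier M\<close> x]
    by (rule coset_absorb[OF gK imageI[OF k] g.hom_closed[OF x]])
  then show ?thesis
    using g_coset[OF z(1)] z(2) by (simp add: C_def)
qed

section \<open>Functoriality of homology on coded spaces\<close>

lemma topspace_code_space: "inj e \<Longrightarrow> topspace (code_space e T) = e ` topspace T"
  by (auto simp: code_space_def topspace_pullback_topology)

lemma pair_map_code_space:
  assumes e: "inj e" "inj e'" and f: "pair_map T S T' S' f"
  shows "pair_map (code_space e T) (e ` S) (code_space e' T') (e' ` S') (e' \<circ> f \<circ> inv_into UNIV e)"
proof -
  have decode: "continuous_map (code_space e T) T (inv_into UNIV e)"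
    unfolding code_space_def
    using continuous_map_pullback[OF continuous_map_id] by (metis id_comp)
  have "inv_into UNIV e' \<circ> e' = id" using e(2) by simp
  then have encode: "continuous_map T' (code_space e' T') e'"
    unfolding code_space_def by (intro continuous_map_pullback') (auto simp: id_def)
  have "continuous_map (code_space e T) (code_space e' T') (e' \<circ> f \<circ> inv_into UNIV e)"
    using f decode encode unfolding pair_map_def by (metis continuous_map_compose comp_assoc)
  then show ?thesis
    using f e by (auto simp: pair_map_def topspace_code_space image_image)
qed

lemma lin_hom_abelian_group_hom:
  assumes "left_module R M" "left_module R N" "h \<in> lin_hom R M N"
  shows "abelian_group_hom M N h"
proof -
  interpret M: left_module R M by fact
  interpret N: left_module R N by fact
  show ?thesis
    using assms(3)
    by (intro abelian_group_homI M.abelian_group_axioms N.abelian_group_axioms group_hom.intro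
        group_hom_axioms.intro M.add.is_group N.add.is_group homI)
      (auto simp: lin_hom_def)
qed

context homology_theory
begin

lemma homology_map_hom:
  assumes "inj e" "inj e'" "pair_map T S T' S' f"
  shows "abelian_group_hom (homology H e n T S) (homology H e' n T' S')
           (homology_map H e e' n T S T' S' f)"
proof -
  note pm = pair_map_code_space[OF assms]
  then show ?thesis
    unfolding homology_def homology_map_def
    by (intro lin_hom_abelian_group_hom[where R = R] left_module_Hmod Hind_hom) (auto simp: pair_map_def)
qed

lemma homology_map_comp:
  assumes "inj e" "inj e'" "inj e''" "pair_map T S T' S' f" "pair_map T' S' T'' S'' g"
    and "x \<in> carrier (homology H e n T S)"
  shows "homology_map H e e'' n T S T'' S'' (g \<circ> f) x =
         homology_map H e' e'' n T' S' T'' S'' g (homology_map H e e' n T S T' S' f x)"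
proof -
  have "e'' \<circ> (g \<circ> f) \<circ> inv_into UNIV e =
        (e'' \<circ> g \<circ> inv_into UNIV e') \<circ> (e' \<circ> f \<circ> inv_into UNIV e)"
    using assms(2) by (simp add: fun_eq_iff)
  then show ?thesis
    using Hind_comp[OF pair_map_code_space[OF assms(1,2,4)] pair_map_code_space[OF assms(2,3,5)]]
      assms(6)
    by (simp add: homology_map_def homology_def)
qed

end

section \<open>Correspondences and their enlargements\<close>

lemma pair_map_fst:
  assumes "correspondence X A Y B F F'" "A \<subseteq> topspace X" "B \<subseteq> topspace Y"
  shows "pair_map (subtopology (prod_topology X Y) F) F' X A fst"
  using assms
  by (auto simp: pair_map_def correspondence_def continuous_map_fst continuous_map_from_subtopology)

lemma pair_map_snd:
  assumes "correspondence X A Y B F F'" "A \<subseteq> topspace X" "B \<subseteq> topspace Y"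
  shows "pair_map (subtopology (prod_topology X Y) F) F' Y B snd"
  using assms
  by (auto simp: pair_map_def correspondence_def continuous_map_snd continuous_map_from_subtopology)

lemma pair_map_enlargement:
  assumes "correspondence X A Y B F F'" "correspondence X A Y B G G'" "enlargement G G' F F'"
  shows "pair_map (subtopology (prod_topology X Y) F) F' (subtopology (prod_topology X Y) G) G' id"
proof -
  have "continuous_map (subtopology (prod_topology X Y) F) (subtopology (prod_topology X Y) G) id"
    using assms(3) unfolding enlargement_def
    by (intro continuous_map_into_subtopology continuous_map_from_subtopology continuous_map_id)
      auto
  then show ?thesis
    using assms by (auto simp: pair_map_def correspondence_def enlargement_def)
qed

locale coded_pairs = homology_theory R H
  for R :: "('r, 's) ring_scheme" and H :: "('u, 'r, 'm) homology_data" +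
  fixes eX :: "'a \<Rightarrow> 'u" and eY :: "'b \<Rightarrow> 'u" and eP :: "'a \<times> 'b \<Rightarrow> 'u"
    and X :: "'a topology" and A :: "'a set" and Y :: "'b topology" and B :: "'b set"
  assumes inj_eX: "inj eX" and inj_eY: "inj eY" and inj_eP: "inj eP"
    and A_sub: "A \<subseteq> topspace X" and B_sub: "B \<subseteq> topspace Y"
begin

lemma p_star_hom:
  assumes "correspondence X A Y B F F'"
  shows "abelian_group_hom (graph_homology H eP X Y n F F') (homology H eX n X A)
           (p_star H eX eP X A Y n F F')"
  unfolding graph_homology_def p_star_def
  by (intro homology_map_hom inj_eP inj_eX pair_map_fst[OF assms] A_sub B_sub)

lemma q_star_hom:
  assumes "correspondence X A Y B F F'"
  shows "abelian_group_hom (graph_homology H eP X Y n F F') (homology H eY n Y B)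
           (q_star H eY eP X Y B n F F')"
  unfolding graph_homology_def q_star_def
  by (intro homology_map_hom inj_eP inj_eY pair_map_snd[OF assms] A_sub B_sub)

lemma ker_p_subgroup:
  assumes "correspondence X A Y B F F'"
  shows "additive_subgroup (ker_p H eX eP X A Y n F F') (graph_homology H eP X Y n F F')"
  unfolding ker_p_def
  by (rule abelian_group_hom.additive_subgroup_a_kernel[OF p_star_hom[OF assms]])

lemma q_ker_p_subgroup:
  assumes "correspondence X A Y B F F'"
  shows "abelian_subgroup (q_ker_p H eX eY eP X A Y B n F F') (homology H eY n Y B)"
  unfolding q_ker_p_def
  by (rule abelian_subgroup_image[OF q_star_hom[OF assms] ker_p_subgroup[OF assms]])

lemma induced_hom_p_star:
  assumes F: "correspondence X A Y B F F'" and x: "x \<in> carrier (graph_homology H eP X Y n F F')"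
  shows "induced_hom H eX eY eP X A Y B n F F' (p_star H eX eP X A Y n F F' x) =
         q_ker_p H eX eY eP X A Y B n F F' +>\<^bsub>homology H eY n Y B\<^esub> q_star H eY eP X Y B n F F' x"
proof -
  have "p_star H eX eP X A Y n F F' x \<in> im_p H eX eP X A Y n F F'"
    using x by (simp add: im_p_def)
  then show ?thesis
    using induced_on_quotients[OF p_star_hom[OF F] q_star_hom[OF F] x]
    by (simp add: induced_hom_def compose_eq q_tilde_def p_tilde_def q_ker_p_def ker_p_def)
qed

definition incl_star ::
  "int \<Rightarrow> ('a \<times> 'b) set \<Rightarrow> ('a \<times> 'b) set \<Rightarrow> ('a \<times> 'b) set \<Rightarrow> ('a \<times> 'b) set \<Rightarrow> 'm \<Rightarrow> 'm" where
  "incl_star n F F' G G' = homology_map H eP eP n (subtopology (prod_topology X Y) F) F'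
     (subtopology (prod_topology X Y) G) G' id"

context
  fixes F F' G G' :: "('a \<times> 'b) set"
  assumes F: "correspondence X A Y B F F'" and G: "correspondence X A Y B G G'"
    and FG: "enlargement G G' F F'"
begin

lemma incl_star_closed:
  assumes "x \<in> carrier (graph_homology H eP X Y n F F')"
  shows "incl_star n F F' G G' x \<in> carrier (graph_homology H eP X Y n G G')"
  using abelian_group_hom.hom_closed[OF homology_map_hom[OF inj_eP inj_eP
        pair_map_enlargement[OF F G FG]]] assms
  by (simp add: incl_star_def graph_homology_def)

lemma p_star_enlargement:
  assumes "x \<in> carrier (graph_homology H eP X Y n F F')"
  shows "p_star H eX eP X A Y n F F' x = p_star H eX eP X A Y n G G' (incl_star n F F' G G' x)"
  using homology_map_comp[OF inj_eP inj_eP inj_eX pair_map_enlargement[OF F G FG]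
      pair_map_fst[OF G A_sub B_sub]] assms
  by (simp add: incl_star_def graph_homology_def p_star_def)

lemma q_star_enlargement:
  assumes "x \<in> carrier (graph_homology H eP X Y n F F')"
  shows "q_star H eY eP X Y B n F F' x = q_star H eY eP X Y B n G G' (incl_star n F F' G G' x)"
  using homology_map_comp[OF inj_eP inj_eP inj_eY pair_map_enlargement[OF F G FG]
      pair_map_snd[OF G A_sub B_sub]] assms
  by (simp add: incl_star_def graph_homology_def q_star_def)

text \<open>An enlargement can fail to be a homological extension only by having a larger
  indeterminacy: the values of the two induced homomorphisms at \<open>p\<^sup>F\<^sub>* x\<close> are cosets of the same
  element \<open>q\<^sup>F\<^sub>* x\<close>.\<close>

lemma homological_extension_if_q_ker_p_subset:
  assumes sub: "\<And>n. q_ker_p H eX eY eP X A Y B n G G' \<subseteq> q_ker_p H eX eY eP X A Y B n F F'"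
  shows "homological_extension H eX eY eP X A Y B G G' F F'"
  unfolding homological_extension_def
proof (intro allI conjI ballI)
  fix n
  show "im_p H eX eP X A Y n F F' \<subseteq> im_p H eX eP X A Y n G G'"
    using p_star_enlargement incl_star_closed by (auto simp: im_p_def)
  show "q_ker_p H eX eY eP X A Y B n G G' \<subseteq> q_ker_p H eX eY eP X A Y B n F F'"
    by (rule sub)
  fix a assume a: "a \<in> im_p H eX eP X A Y n F F'"
  then obtain x where x: "x \<in> carrier (graph_homology H eP X Y n F F')"
    and ax: "a = p_star H eX eP X A Y n F F' x"
    by (auto simp: im_p_def)
  let ?HY = "homology H eY n Y B" and ?y = "q_star H eY eP X Y B n F F' x"
  let ?KF = "q_ker_p H eX eY eP X A Y B n F F'" and ?KG = "q_ker_p H eX eY eP X A Y B n G G'"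
  have y: "?y \<in> carrier ?HY"
    by (rule abelian_group_hom.hom_closed[OF q_star_hom[OF F] x])
  have "induced_hom H eX eY eP X A Y B n G G' a = ?KG +>\<^bsub>?HY\<^esub> ?y"
    using induced_hom_p_star[OF G incl_star_closed[OF x]]
    by (simp add: ax p_star_enlargement[OF x] q_star_enlargement[OF x])
  moreover have "proj_quot H eX eY eP X A Y B n G G' F F' (?KG +>\<^bsub>?HY\<^esub> ?y) = ?KF +>\<^bsub>?HY\<^esub> ?y"
    unfolding proj_quot_def
    using y sub by (intro quotient_map_of_coset q_ker_p_subgroup G coset_absorb F) auto
  moreover have "induced_hom H eX eY eP X A Y B n F F' a = ?KF +>\<^bsub>?HY\<^esub> ?y"
    using induced_hom_p_star[OF F x] ax by simp
  ultimately show "induced_hom H eX eY eP X A Y B n F F' a =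
      (proj_quot H eX eY eP X A Y B n G G' F F' \<circ> induced_hom H eX eY eP X A Y B n G G' \<circ>
        incl_im H eX eP X A Y n F F') a"
    using a by (simp add: incl_im_def)
qed

end

lemma q_ker_p_consistent:
  assumes "homologically_consistent H eX eY eP X A Y B G G'"
  shows "q_ker_p H eX eY eP X A Y B n G G' \<subseteq> {\<zero>\<^bsub>homology H eY n Y B\<^esub>}"
  using assms by (auto simp: homologically_consistent_def q_ker_p_def ker_q_def a_kernel_def')

end

theorem proposition4p3:
  fixes R :: "('r, 's) ring_scheme"
    and H :: "('u, 'r, 'm) homology_data"
    and eX :: "'a \<Rightarrow> 'u" and eY :: "'b \<Rightarrow> 'u" and eP :: "'a \<times> 'b \<Rightarrow> 'u"
    and X :: "'a topology" and A :: "'a set"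
    and Y :: "'b topology" and B :: "'b set"
    and F F' G G' :: "('a \<times> 'b) set"
  assumes "homology_theory R H"
    and "inj eX" and "inj eY" and "inj eP"
    and "A \<subseteq> topspace X" and "B \<subseteq> topspace Y"
    and "closed_correspondence X A Y B F F'"
    and "closed_correspondence X A Y B G G'"
    and "enlargement G G' F F'"
    and "homologically_consistent H eX eY eP X A Y B G G'"
  shows "homological_extension H eX eY eP X A Y B G G' F F'"
proof -
  interpret coded_pairs R H eX eY eP X A Y B
    using assms by (simp add: coded_pairs_def coded_pairs_axioms_def)
  have F: "correspondence X A Y B F F'" and G: "correspondence X A Y B G G'"
    using assms by (simp_all add: closed_correspondence_def)
  have "q_ker_p H eX eY eP X A Y B n G G' \<subseteq> q_ker_p H eX eY eP X A Y B n F F'" for n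
    using q_ker_p_consistent[OF assms(10)]
      additive_subgroup.zero_closed[OF abelian_subgroup.axioms(1)[OF q_ker_p_subgroup[OF F]]]
    by blast
  then show ?thesis
    by (rule homological_extension_if_q_ker_p_subset[OF F G assms(9)])
qed

end
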